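(* Let $n\ge 1$ and let $\tau^{(n)}$ be the time of permanent detachment of the $n$-detachment process. Then the random variable $\tau^{(n)}$ (1) is almost surely finite, with a tail asymptotic to $n(n-1)/k$ as $k\to\infty$ (that is, $P(\tau^{(n)}>k)\sim \dfrac{n(n-1)}{k}$ as $k\to\infty$ with $n$ fixed), and thus has infinite expectation; (2) has distribution function $$F^{(n)}(k)=P(\tau^{(n)}\le k)=\frac{\binom{k}{n}}{\binom{k+n-1}{n}},$$ using the convention $\binom{a}{b}:=0$ when $a<b$.
   Context: The $n$-detachment process ($n\ge1$): there are $n$ labeled passengers. At time $1$ all passengers sit in bus number $1$. At each integer time $k\ge 2$, a new bus with number $k$ becomes available and each passenger (currently sitting in one of the buses $1,\dots,k-1$), independently of the others and of the past, relocates to bus $k$ with probability $1/k$ and otherwise stays where they are. A passenger is lonely at time $k$ if no other passenger is in the same bus at time $k$; $L_k$ denotes the number of lonely passengers at time $k$. The time of permanent detachment is $\tau^{(n)}:=\min\{k\ge 1 : L_{k+j}=n\ \text{for all } j\ge 0\}$ (with $\min\emptyset=\infty$). Here $k$ ranges over the positive integers, and $a_k\sim b_k$ means $a_k/b_k\to1$.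
   Formalization: Infinite expectation is stated only for n ≥ 2, since for n = 1 one has τ = 1 and expectation 1; for n = 1 the tail asymptotic, where the ratio would be 0/0, is read as both sides being eventually zero. *)

theory Defs
  imports "HOL-Probability.Probability" "HOL-Library.Landau_Symbols"
begin

text \<open>
  \<open>B k i \<omega>\<close> is the number of the bus in which passenger \<open>i < n\<close> sits at time \<open>k \<ge> 1\<close>.
  The values of \<open>B\<close> at time 0 and for \<open>i \<ge> n\<close> are irrelevant.  Since all buses occupied
  before time \<open>k\<close> have numbers below \<open>k\<close>, the event \<open>B k i = k\<close> says that passenger \<open>i\<close>
  relocates at time \<open>k\<close>.  The positions up to time \<open>k - 1\<close> are functions of the relocation
  events up to time \<open>k - 1\<close>, so relocating independently of the other passengers and of the
  past amounts to joint independence of all relocation events.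
\<close>

locale detachment_process = prob_space M
  for M :: "'a measure" and n :: nat and B :: "nat \<Rightarrow> nat \<Rightarrow> 'a \<Rightarrow> nat" +
  assumes random_variable_bus:
      "\<And>k i. 1 \<le> k \<Longrightarrow> i < n \<Longrightarrow> B k i \<in> measurable M (count_space UNIV)"
    and initial_bus:
      "\<And>i \<omega>. i < n \<Longrightarrow> \<omega> \<in> space M \<Longrightarrow> B 1 i \<omega> = 1"
    and relocate_or_stay:
      "\<And>k i \<omega>. 2 \<le> k \<Longrightarrow> i < n \<Longrightarrow> \<omega> \<in> space M \<Longrightarrow> B k i \<omega> = k \<or> B k i \<omega> = B (k - 1) i \<omega>"
    and prob_relocate:
      "\<And>k i. 2 \<le> k \<Longrightarrow> i < n \<Longrightarrow> prob {\<omega> \<in> space M. B k i \<omega> = k} = 1 / real k"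
    and indep_relocations:
      "indep_events (\<lambda>(k, i). {\<omega> \<in> space M. B k i \<omega> = k}) ({2..} \<times> {..<n})"

definition lonely :: "nat \<Rightarrow> (nat \<Rightarrow> nat \<Rightarrow> 'a \<Rightarrow> nat) \<Rightarrow> nat \<Rightarrow> nat \<Rightarrow> 'a \<Rightarrow> bool" where
  "lonely n B k i \<omega> \<longleftrightarrow> (\<forall>j<n. j \<noteq> i \<longrightarrow> B k j \<omega> \<noteq> B k i \<omega>)"

definition num_lonely :: "nat \<Rightarrow> (nat \<Rightarrow> nat \<Rightarrow> 'a \<Rightarrow> nat) \<Rightarrow> nat \<Rightarrow> 'a \<Rightarrow> nat" where
  "num_lonely n B k \<omega> = card {i. i < n \<and> lonely n B k i \<omega>}"

text \<open>
  In \<^typ>\<open>enat\<close> the infimum of a nonempty set is its minimum, and the infimum of the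
  empty set is \<open>\<infinity>\<close>.
\<close>

definition permanent_detachment_time :: "nat \<Rightarrow> (nat \<Rightarrow> nat \<Rightarrow> 'a \<Rightarrow> nat) \<Rightarrow> 'a \<Rightarrow> enat" where
  "permanent_detachment_time n B \<omega> = Inf (enat ` {k. 1 \<le> k \<and> (\<forall>j. num_lonely n B (k + j) \<omega> = n)})"

end

theory Submission
  imports Defs "HOL-Real_Asymp.Real_Asymp"
begin

text \<open>
  Once all passengers sit in different buses, they remain separated at time \<open>m\<close> if and only if at
  most one of them relocates. Hence \<open>\<tau> \<le> k\<close> means that the passengers are separated at time \<open>k\<close> and
  that at each later time at most one of them moves, and these events are independent. The
  positions at time \<open>k\<close> are independent and uniform on \<open>{1..k}\<close>, so the former event has probability
  \<open>\<Prod>i<n. (1 - i / k)\<close>. At most one passenger moves at time \<open>m\<close> with probability \<open>g m / g (m - 1)\<close>,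
  where \<open>g m = (\<Prod>i<n. (1 + i / m))\<close>; these factors telescope to \<open>1 / g k\<close>, since \<open>g\<close> tends to 1.
  Thus \<open>P(\<tau> \<le> k) = (\<Prod>i<n. (k - i) / (k + i))\<close>.
\<close>

section \<open>Products and binomial coefficients\<close>

text \<open>Numerator and denominator are the falling and the rising factorial of \<open>k\<close>,
  each equal to \<open>fact n\<close> times a binomial coefficient, and the factorials cancel. For
  \<open>k < n\<close> both sides are zero, on the left because of the factor
  \<open>i = k\<close>.\<close>

lemma prod_div_eq_binomial_ratio:
  assumes "1 \<le> k" "1 \<le> n"
  shows "(\<Prod>i<n. (real k - real i) / (real k + real i))
    = real (k choose n) / real ((k + n - 1) choose n)"
proof -
  have "(\<Prod>i<n. real k - real i) = real (k choose n) * fact n"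
    by (simp add: binomial_gbinomial gbinomial_prod_rev atLeast0LessThan)
  moreover have "(\<Prod>i<n. real k + real i) = real ((k + n - 1) choose n) * fact n"
  proof -
    have "(\<Prod>i<n. real k + real i) = pochhammer (real k) n"
      by (simp add: pochhammer_prod atLeast0LessThan)
    also have "\<dots> = (real (k + n - 1) gchoose n) * fact n"
      using assms by (simp add: gbinomial_pochhammer' of_nat_diff)
    finally show ?thesis
      by (simp add: binomial_gbinomial)
  qed
  ultimately show ?thesis
    by (simp add: prod_dividef)
qed

text \<open>The identity behind the telescoping: the first two factors form the probability that at
  most one passenger moves at time \<open>m\<close>. Passing from \<open>n\<close> to
  \<open>Suc n\<close> multiplies both sides by \<open>1 + n / m\<close>.\<close>

lemma prod_one_plus_step:
  fixes m :: real
  assumes "1 < m"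
  shows "((m - 1) / m) ^ n * (1 + real n / (m - 1)) * (\<Prod>i<n. 1 + real i / (m - 1))
    = (\<Prod>i<n. 1 + real i / m)"
proof (induction n)
  case (Suc n)
  let ?c = "((m - 1) / m) * (1 + real (Suc n) / (m - 1))"
  have "((m - 1) / m) ^ Suc n * (1 + real (Suc n) / (m - 1)) * (\<Prod>i<Suc n. 1 + real i / (m - 1))
     = ?c * (((m - 1) / m) ^ n * (1 + real n / (m - 1)) * (\<Prod>i<n. 1 + real i / (m - 1)))"
    by simp
  also have "\<dots> = ?c * (\<Prod>i<n. 1 + real i / m)"
    by (simp only: Suc.IH)
  also have "?c = 1 + real n / m"
    using assms by (simp add: field_simps)
  finally show ?case by simp
qed auto

section \<open>Limits and asymptotics of the products\<close>

lemma tendsto_prod_one_plus: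
  "(\<lambda>k::nat. \<Prod>i<n. 1 + real i / real k) \<longlonglongrightarrow> 1"
proof -
  have "(\<lambda>k::nat. \<Prod>i<n. 1 + real i / real k) \<longlonglongrightarrow> (\<Prod>i<n. 1 + 0)"
    by (intro tendsto_prod tendsto_add tendsto_const lim_const_over_n)
  then show ?thesis by simp
qed

lemma tendsto_prod_ratio:
  "(\<lambda>k::nat. \<Prod>i<n. (real k - real i) / (real k + real i)) \<longlonglongrightarrow> 1"
proof -
  have "(\<lambda>k::nat. (real k - real i) / (real k + real i)) \<longlonglongrightarrow> 1" for i
    by real_asymp
  then have "(\<lambda>k::nat. \<Prod>i<n. (real k - real i) / (real k + real i)) \<longlonglongrightarrow> (\<Prod>i<n. 1)"
    by (intro tendsto_prod)
  then show ?thesis by simp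
qed

text \<open>The factor with index \<open>n\<close> equals \<open>1 - 2 * n / (k + n)\<close>, so it
  adds \<open>2 * n\<close> to the limit; the sum of \<open>2 * i\<close> over \<open>i < n\<close>
  is \<open>n * (n - 1)\<close>.\<close>

lemma tendsto_scaled_prod_ratio:
  "(\<lambda>k::nat. real k * (1 - (\<Prod>i<n. (real k - real i) / (real k + real i))))
     \<longlonglongrightarrow> real n * (real n - 1)"
proof (induction n)
  case (Suc n)
  let ?p = "\<lambda>k::nat. \<Prod>i<n. (real k - real i) / (real k + real i)"
  have "(\<lambda>k::nat. real k * (2 * real n / (real k + real n))) \<longlonglongrightarrow> 2 * real n"
    by (cases "n = 0") (simp, real_asymp)
  then have "(\<lambda>k. real k * (1 - ?p k) + ?p k * (real k * (2 * real n / (real k + real n))))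
      \<longlonglongrightarrow> real n * (real n - 1) + 1 * (2 * real n)"
    by (rule tendsto_add[OF Suc tendsto_mult[OF tendsto_prod_ratio]])
  moreover have "\<forall>\<^sub>F k in sequentially.
      real k * (1 - ?p k) + ?p k * (real k * (2 * real n / (real k + real n)))
      = real k * (1 - (\<Prod>i<Suc n. (real k - real i) / (real k + real i)))"
    using eventually_gt_at_top[of "0::nat"]
  proof eventually_elim
    case (elim k)
    then have "(real k - real n) / (real k + real n) = 1 - 2 * real n / (real k + real n)"
      by (simp add: field_simps)
    then have "(\<Prod>i<Suc n. (real k - real i) / (real k + real i))
        = ?p k * (1 - 2 * real n / (real k + real n))"
      by simp
    then show ?case by (simp only: right_diff_distrib mult.left_commute mult_1_right)
  qed
  ultimately have "(\<lambda>k. real k * (1 - (\<Prod>i<Suc n. (real k - real i) / (real k + real i))))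
      \<longlonglongrightarrow> real n * (real n - 1) + 1 * (2 * real n)"
    by (rule Lim_transform_eventually)
  then show ?case by (simp add: algebra_simps)
qed auto

text \<open>For \<open>n \<ge> 2\<close> the scaled limit is a nonzero constant, which gives the
  equivalence. For \<open>n \<le> 1\<close> that constant is 0, but both sides vanish eventually,
  and \<open>asymp_equiv\<close> counts the quotient 0/0 as 1.\<close>

lemma asymp_equiv_one_minus_prod_ratio:
  "(\<lambda>k::nat. 1 - (\<Prod>i<n. (real k - real i) / (real k + real i)))
     \<sim>[at_top] (\<lambda>k. real n * (real n - 1) / real k)"
proof (cases "n \<le> 1")
  case True
  have "\<forall>\<^sub>F k::nat in at_top. 1 - (\<Prod>i<n. (real k - real i) / (real k + real i)) = 0"
    using eventually_gt_at_top[of "0::nat"]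
    by eventually_elim (use True in \<open>auto simp: le_Suc_eq\<close>)
  moreover have "real n * (real n - 1) = 0"
    using True by (auto simp: le_Suc_eq)
  ultimately show ?thesis
    by (subst asymp_equiv_cong[where ?f2.0="\<lambda>_. 0" and ?g2.0="\<lambda>_. 0"]) auto
next
  case False
  then have nz: "real n * (real n - 1) \<noteq> 0" by auto
  have "(\<lambda>k::nat. (1 - (\<Prod>i<n. (real k - real i) / (real k + real i))) / (1 / real k))
      \<longlonglongrightarrow> real n * (real n - 1)"
    using tendsto_scaled_prod_ratio[of n] by (simp add: mult.commute)
  from asymp_equivI'_const[OF this nz] show ?thesis by simp
qed

text \<open>Stated for an arbitrary measure space because it serves both \<open>M\<close> and the
  smaller sigma-algebras generated by relocations.\<close>

lemma sets_Collect_inj_on: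
  fixes X :: "'i \<Rightarrow> 'b \<Rightarrow> 'c :: countable"
  assumes "finite I" "\<And>i. i \<in> I \<Longrightarrow> X i \<in> measurable N (count_space UNIV)"
  shows "{\<omega> \<in> space N. inj_on (\<lambda>i. X i \<omega>) I} \<in> sets N"
  unfolding inj_on_def
proof (intro sets.sets_Collect_finite_All assms(1))
  fix i j assume "i \<in> I" "j \<in> I"
  then have [measurable]: "X i \<in> measurable N (count_space UNIV)" "X j \<in> measurable N (count_space UNIV)"
    using assms(2) by blast+
  show "{\<omega> \<in> space N. X i \<omega> = X j \<omega> \<longrightarrow> i = j} \<in> sets N"
    by measurable
qed

section \<open>Independence of the relocations\<close>

lemma (in prob_space) prob_Ball_indep_sets:
  assumes "indep_sets F J" "finite J"
    and "\<And>j. j \<in> J \<Longrightarrow> {\<omega> \<in> space M. P j \<omega>} \<in> F j"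
  shows "prob {\<omega> \<in> space M. \<forall>j\<in>J. P j \<omega>} = (\<Prod>j\<in>J. prob {\<omega> \<in> space M. P j \<omega>})"
proof (cases "J = {}")
  case False
  then have "{\<omega> \<in> space M. \<forall>j\<in>J. P j \<omega>} = (\<Inter>j\<in>J. {\<omega> \<in> space M. P j \<omega>})"
    by auto
  then show ?thesis
    using indep_setsD[OF assms(1) _ False assms(2), of "\<lambda>j. {\<omega> \<in> space M. P j \<omega>}"] assms(3)
    by simp
qed (simp add: prob_space)

context detachment_process
begin

definition relocation :: "nat \<times> nat \<Rightarrow> 'a set" where
  "relocation = (\<lambda>(k, i). {\<omega> \<in> space M. B k i \<omega> = k})"

lemma relocation_in_events:
  "x \<in> {2..} \<times> {..<n} \<Longrightarrow> relocation x \<in> events"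
  using indep_relocations by (auto simp: indep_events_def relocation_def)

text \<open>Grouping principle: disjoint blocks of independent events generate independent
  sigma-algebras. The generators may be grouped because singleton families are trivially stable
  under intersection.\<close>

lemma indep_sets_relocations:
  assumes "disjoint_family_on I J" "(\<Union>j\<in>J. I j) \<subseteq> {2..} \<times> {..<n}"
  shows "indep_sets (\<lambda>j. sets (sigma (space M) (relocation ` I j))) J"
proof -
  have "indep_sets (\<lambda>x. {relocation x}) (\<Union>j\<in>J. I j)"
    using indep_relocations assms(2) indep_sets_mono_index
    unfolding indep_events_def_alt relocation_def by blast
  then have "indep_sets (\<lambda>j. sigma_sets (space M) (\<Union>x\<in>I j. {relocation x})) J"
    by (rule indep_sets_collect_sigma) (auto simp: Int_stable_def assms(1))
  moreover have "relocation ` I j \<subseteq> Pow (space M)" for j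
    by (auto simp: relocation_def)
  moreover have "(\<Union>x\<in>I j. {relocation x}) = relocation ` I j" for j
    by auto
  ultimately show ?thesis
    by (simp add: sets_measure_of)
qed

lemma space_sigma_relocation [simp]: "space (sigma (space M) (relocation ` I)) = space M"
  by (rule space_measure_of) (auto simp: relocation_def)

lemma pred_relocation:
  assumes "(k, i) \<in> I"
  shows "Measurable.pred (sigma (space M) (relocation ` I)) (\<lambda>\<omega>. B k i \<omega> = k)"
proof -
  have sub: "relocation ` I \<subseteq> Pow (space M)"
    by (auto simp: relocation_def)
  have "relocation (k, i) \<in> sets (sigma (space M) (relocation ` I))"
    using assms sub by (simp add: sets_measure_of)
  moreover have "relocation (k, i) = {\<omega> \<in> space M. B k i \<omega> = k}"
    by (simp add: relocation_def)
  ultimately show ?thesis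
    by (simp add: pred_def)
qed

text \<open>A position is a function of the passenger's own relocations so far. This is what later
  makes separation at time \<open>k\<close> independent of the moves after \<open>k\<close>.\<close>

lemma measurable_position:
  assumes "i < n" "1 \<le> k" "{2..k} \<times> {i} \<subseteq> I"
  shows "B k i \<in> measurable (sigma (space M) (relocation ` I)) (count_space UNIV)"
  using assms(2,3)
proof (induction k rule: dec_induct)
  case base
  show ?case
    by (subst measurable_cong[where g="\<lambda>_. 1"]) (use assms(1) initial_bus in auto)
next
  case (step k)
  have [measurable]: "B k i \<in> measurable (sigma (space M) (relocation ` I)) (count_space UNIV)"
    by (rule step.IH) (use step.prems in auto)
  have [measurable]: "Measurable.pred (sigma (space M) (relocation ` I)) (\<lambda>\<omega>. B (Suc k) i \<omega> = Suc k)"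
    by (rule pred_relocation) (use step in auto)
  have "B (Suc k) i \<omega> = (if B (Suc k) i \<omega> = Suc k then Suc k else B k i \<omega>)" if "\<omega> \<in> space M" for \<omega>
    using relocate_or_stay[of "Suc k" i \<omega>] that assms(1) step.hyps by auto
  then show ?case
    by (subst measurable_cong[where g="\<lambda>\<omega>. if B (Suc k) i \<omega> = Suc k then Suc k else B k i \<omega>"])
      (simp_all, measurable)
qed

text \<open>\<open>Q\<close> receives the truth value of the relocation, so one product formula
  covers cells where a move is required, forbidden or left free.\<close>

lemma prob_grid:
  assumes "finite J" "J \<subseteq> {2..} \<times> {..<n}"
  shows "prob {\<omega> \<in> space M. \<forall>(m, i)\<in>J. Q m i (B m i \<omega> = m)}
    = (\<Prod>(m, i)\<in>J. prob {\<omega> \<in> space M. Q m i (B m i \<omega> = m)})"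
proof -
  have "indep_sets (\<lambda>j. sets (sigma (space M) (relocation ` {j}))) J"
    by (rule indep_sets_relocations) (use assms in \<open>auto simp: disjoint_family_on_def\<close>)
  then have "prob {\<omega> \<in> space M. \<forall>j\<in>J. Q (fst j) (snd j) (B (fst j) (snd j) \<omega> = fst j)}
    = (\<Prod>j\<in>J. prob {\<omega> \<in> space M. Q (fst j) (snd j) (B (fst j) (snd j) \<omega> = fst j)})"
  proof (rule prob_Ball_indep_sets[OF _ assms(1)])
    fix j assume "j \<in> J"
    obtain m i where j: "j = (m, i)" by force
    let ?N = "sigma (space M) (relocation ` {(m, i)})"
    have [measurable]: "Measurable.pred ?N (\<lambda>\<omega>. B m i \<omega> = m)"
      by (rule pred_relocation) simp
    \<comment> \<open>Splitting on the truth value turns the arbitrary \<open>Q\<close> into a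
      Boolean combination of the generating event and constants.\<close>
    have "{\<omega> \<in> space ?N. (B m i \<omega> = m \<and> Q m i True) \<or> (B m i \<omega> \<noteq> m \<and> Q m i False)} \<in> sets ?N"
      by measurable
    also have "{\<omega> \<in> space ?N. (B m i \<omega> = m \<and> Q m i True) \<or> (B m i \<omega> \<noteq> m \<and> Q m i False)}
        = {\<omega> \<in> space M. Q m i (B m i \<omega> = m)}"
      unfolding space_sigma_relocation by (intro Collect_cong) metis
    finally show "{\<omega> \<in> space M. Q (fst j) (snd j) (B (fst j) (snd j) \<omega> = fst j)}
        \<in> sets (sigma (space M) (relocation ` {j}))"
      by (simp only: j fst_conv snd_conv)
  qed
  then show ?thesis
    by (simp add: case_prod_beta)
qed

lemma prob_not_relocate:
  assumes "2 \<le> m" "i < n"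
  shows "prob {\<omega> \<in> space M. B m i \<omega> \<noteq> m} = 1 - 1 / real m"
proof -
  have "{\<omega> \<in> space M. B m i \<omega> = m} \<in> events"
    using relocation_in_events[of "(m, i)"] assms by (simp add: relocation_def)
  then show ?thesis
    using prob_neg[of "\<lambda>\<omega>. B m i \<omega> = m"] prob_relocate[OF assms] by simp
qed

section \<open>The positions at a fixed time\<close>

lemma position_range:
  assumes "i < n" "1 \<le> k" "\<omega> \<in> space M"
  shows "B k i \<omega> \<in> {1..k}"
  using assms(2)
proof (induction k rule: dec_induct)
  case (step k)
  then show ?case
    using relocate_or_stay[of "Suc k" i \<omega>] assms by auto
qed (use assms initial_bus in auto)

text \<open>The current bus is the one entered at the last relocation: a move at time
  \<open>c\<close>, none later, anything before. For \<open>c = 1\<close> no move at all is allowed,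
  since times start at 2. The disjunct \<open>k < c\<close>, for which the right side is vacuous,
  carries the induction up to time \<open>c\<close>.\<close>

lemma position_eq_iff:
  assumes "i < n" "1 \<le> k" "\<omega> \<in> space M" "1 \<le> c"
  shows "k < c \<or> B k i \<omega> = c \<longleftrightarrow>
    (\<forall>m\<in>{2..k}. m < c \<or> (m = c) = (B m i \<omega> = m))"
  using assms(2)
proof (induction k rule: dec_induct)
  case base
  then show ?case using assms initial_bus by auto
next
  case (step k)
  have "{2..Suc k} = insert (Suc k) {2..k}"
    using step.hyps by auto
  moreover have "B k i \<omega> \<le> k"
    using position_range[of i k \<omega>] assms step.hyps by auto
  moreover have "B (Suc k) i \<omega> = Suc k \<or> B (Suc k) i \<omega> = B k i \<omega>"
    using relocate_or_stay[of "Suc k" i \<omega>] assms step.hyps by auto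
  ultimately show ?case
    using step.IH by auto
qed

text \<open>From time \<open>c\<close> on the product is \<open>1 / c\<close> times the factors
  \<open>(m - 1) / m\<close> for \<open>c < m \<le> k\<close>, which telescope to
  \<open>1 / k\<close> independently of \<open>c\<close>.\<close>

lemma prod_position_factors:
  assumes "1 \<le> k" "1 \<le> c"
  shows "(\<Prod>m\<in>{2..k}. if m < c then 1 else if m = c then 1 / real m else 1 - 1 / real m)
    = (if k < c then 1 else 1 / real k)"
  using assms(1)
proof (induction k rule: dec_induct)
  case base
  then show ?case using assms by auto
next
  case (step k)
  have "{2..Suc k} = insert (Suc k) {2..k}"
    using step.hyps by auto
  then show ?case
    using step assms by (auto simp: field_simps)
qed

text \<open>Joint uniformity: each assignment of buses is a condition on the relocation grid, and
  each passenger's column contributes \<open>1 / k\<close>.\<close>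

lemma prob_positions:
  assumes "1 \<le> k" "f \<in> {..<n} \<rightarrow> {1..k}"
  shows "prob {\<omega> \<in> space M. \<forall>i<n. B k i \<omega> = f i} = 1 / real k ^ n"
proof -
  define Q where "Q = (\<lambda>m i b. m < f i \<or> (m = f i) = b)"
  have "B k i \<omega> = f i \<longleftrightarrow> (\<forall>m\<in>{2..k}. Q m i (B m i \<omega> = m))" if "i < n" "\<omega> \<in> space M" for i \<omega>
  proof -
    have "f i \<in> {1..k}" using assms that by auto
    then show ?thesis
      using position_eq_iff[of i k \<omega> "f i"] that assms(1) by (auto simp: Q_def)
  qed
  then have "{\<omega> \<in> space M. \<forall>i<n. B k i \<omega> = f i}
     = {\<omega> \<in> space M. \<forall>(m, i)\<in>{2..k} \<times> {..<n}. Q m i (B m i \<omega> = m)}"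
    by auto
  also have "prob \<dots> = (\<Prod>(m, i)\<in>{2..k} \<times> {..<n}. prob {\<omega> \<in> space M. Q m i (B m i \<omega> = m)})"
    by (rule prob_grid) auto
  also have "\<dots> = (\<Prod>(m, i)\<in>{2..k} \<times> {..<n}.
      if m < f i then 1 else if m = f i then 1 / real m else 1 - 1 / real m)"
    by (intro prod.cong)
      (auto simp: Q_def prob_space prob_relocate prob_not_relocate)
  also have "\<dots> = (\<Prod>i<n. \<Prod>m\<in>{2..k}.
      if m < f i then 1 else if m = f i then 1 / real m else 1 - 1 / real m)"
    \<comment> \<open>The grid is multiplied passenger by passenger, so that the factors telescope
      in time.\<close>
    by (subst prod.swap) (simp add: prod.cartesian_product)
  also have "\<dots> = (\<Prod>i<n. 1 / real k)"
  proof (intro prod.cong refl)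
    fix i assume "i \<in> {..<n}"
    then have "f i \<in> {1..k}" using assms by auto
    then show "(\<Prod>m\<in>{2..k}. if m < f i then 1 else if m = f i then 1 / real m else 1 - 1 / real m)
        = 1 / real k"
      using prod_position_factors[of k "f i"] assms(1) by simp
  qed
  finally show ?thesis
    by (simp add: power_one_over)
qed

definition separated :: "nat \<Rightarrow> 'a \<Rightarrow> bool" where
  "separated k \<omega> \<longleftrightarrow> inj_on (\<lambda>i. B k i \<omega>) {..<n}"

lemma separated_iff:
  "separated k \<omega> \<longleftrightarrow> (\<forall>i<n. \<forall>j<n. i \<noteq> j \<longrightarrow> B k i \<omega> \<noteq> B k j \<omega>)"
  by (auto simp: separated_def inj_on_def)

lemma pred_position:
  assumes "1 \<le> k" "i < n"
  shows "Measurable.pred M (\<lambda>\<omega>. B k i \<omega> = c)"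
  using random_variable_bus[OF assms] by measurable

text \<open>By uniformity only the injections from passengers to buses have to be counted.\<close>

lemma prob_separated:
  assumes "1 \<le> k"
  shows "prob {\<omega> \<in> space M. separated k \<omega>} = (\<Prod>i<n. 1 - real i / real k)"
proof -
  \<comment> \<open>Extensional functions make the index set finite and ensure that different
    indices differ at some passenger, so the events are disjoint.\<close>
  let ?F = "{f \<in> {..<n} \<rightarrow>\<^sub>E {1..k}. inj_on f {..<n}}"
  let ?A = "\<lambda>f. {\<omega> \<in> space M. \<forall>i<n. B k i \<omega> = f i}"
  have union: "{\<omega> \<in> space M. separated k \<omega>} = (\<Union>f\<in>?F. ?A f)"
  proof (intro equalityI subsetI)
    fix \<omega> assume \<omega>: "\<omega> \<in> {\<omega> \<in> space M. separated k \<omega>}"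
    define f where "f = restrict (\<lambda>i. B k i \<omega>) {..<n}"
    have "f \<in> ?F"
      using \<omega> position_range[of _ k \<omega>] assms by (auto simp: f_def separated_def inj_on_def)
    moreover have "\<omega> \<in> ?A f"
      using \<omega> by (auto simp: f_def)
    ultimately show "\<omega> \<in> (\<Union>f\<in>?F. ?A f)" by blast
  qed (auto simp: separated_def inj_on_def)
  have "prob {\<omega> \<in> space M. separated k \<omega>} = (\<Sum>f\<in>?F. prob (?A f))"
    unfolding union
  proof (rule finite_measure_finite_Union)
    show "finite ?F"
      by (rule finite_subset[of _ "{..<n} \<rightarrow>\<^sub>E {1..k}"]) (auto intro: finite_PiE)
    show "?A ` ?F \<subseteq> events"
    proof (rule image_subsetI)
      fix f
      have [measurable]: "Measurable.pred M (\<lambda>\<omega>. B k i \<omega> = f i)" if "i < n" for i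
        using that pred_position assms by simp
      have "?A f = {\<omega> \<in> space M. \<forall>i\<in>{..<n}. B k i \<omega> = f i}"
        by auto
      also have "\<dots> \<in> events"
        by measurable
      finally show "?A f \<in> events" .
    qed
    show "disjoint_family_on ?A ?F"
    proof (unfold disjoint_family_on_def, intro ballI impI)
      fix f g assume fg: "f \<in> ?F" "g \<in> ?F" "f \<noteq> g"
      then obtain i where "i < n" "f i \<noteq> g i"
        by (metis (no_types, lifting) PiE_ext lessThan_iff mem_Collect_eq)
      then show "?A f \<inter> ?A g = {}" by auto
    qed
  qed
  also have "\<dots> = (\<Sum>f\<in>?F. 1 / real k ^ n)"
  proof (rule sum.cong[OF refl])
    fix f assume "f \<in> ?F"
    then have "f \<in> {..<n} \<rightarrow> {1..k}"
      by (simp add: PiE_iff Pi_iff)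
    then show "prob (?A f) = 1 / real k ^ n"
      by (rule prob_positions[OF assms])
  qed
  also have "\<dots> = real (\<Prod>i<n. k - i) / real k ^ n"
    using card_inj_on_subset_funcset[of "{..<n}" "{1..k}" "{..<n}"] by (simp add: atLeast0LessThan)
  also have "\<dots> = (\<Prod>i<n. 1 - real i / real k)"
  \<comment> \<open>Subtraction on naturals truncates, so it agrees with real subtraction factorwise
    only for \<open>n \<le> k\<close>; otherwise both products contain the zero factor
    \<open>i = k\<close>.\<close>
  proof (cases "n \<le> k")
    case True
    have "real (\<Prod>i<n. k - i) / real k ^ n = (\<Prod>i<n. real (k - i) / real k)"
      by (simp add: prod_dividef)
    also have "\<dots> = (\<Prod>i<n. 1 - real i / real k)"
      using True assms by (intro prod.cong refl) (auto simp: of_nat_diff field_simps)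
    finally show ?thesis .
  next
    case False
    then have "(\<Prod>i<n. k - i) = 0"
      by (intro prod_zero) (auto intro!: bexI[of _ k])
    moreover have "(\<Prod>i<n. 1 - real i / real k) = 0"
      using False assms by (intro prod_zero) (auto intro!: bexI[of _ k])
    ultimately show ?thesis by (simp only: of_nat_0 div_0)
  qed
  finally show ?thesis .
qed

section \<open>Staying separated\<close>

text \<open>Unlike separation, this condition depends on the relocations at time \<open>m\<close>
  alone, so independence over time applies.\<close>

definition few_moves :: "nat \<Rightarrow> 'a \<Rightarrow> bool" where
  "few_moves m \<omega> \<longleftrightarrow> (\<forall>i<n. \<forall>j<n. B m i \<omega> = m \<and> B m j \<omega> = m \<longrightarrow> i = j)"

text \<open>Two movers would share bus \<open>Suc k\<close>; a single mover enters a bus that was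
  empty before, and those who stay keep their distinct buses.\<close>

lemma separated_Suc_iff:
  assumes "1 \<le> k" "\<omega> \<in> space M" "separated k \<omega>"
  shows "separated (Suc k) \<omega> \<longleftrightarrow> few_moves (Suc k) \<omega>"
proof
  assume "separated (Suc k) \<omega>"
  then show "few_moves (Suc k) \<omega>"
    unfolding separated_iff few_moves_def by metis
next
  assume few: "few_moves (Suc k) \<omega>"
  show "separated (Suc k) \<omega>"
    unfolding separated_iff
  proof (intro allI impI)
    fix i j assume ij: "i < n" "j < n" "i \<noteq> j"
    have "B (Suc k) l \<omega> = Suc k \<or> B (Suc k) l \<omega> = B k l \<omega>" "B k l \<omega> \<le> k" if "l < n" for l
      using relocate_or_stay[of "Suc k" l \<omega>] position_range[of l k \<omega>] that assms by auto
    then show "B (Suc k) i \<omega> \<noteq> B (Suc k) j \<omega>"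
      using ij few assms(3) unfolding separated_iff few_moves_def
      by (metis Suc_n_not_le_n)
  qed
qed

text \<open>Rewrites separation throughout an interval as a conjunction of conditions on disjoint
  sets of relocations.\<close>

lemma separated_interval_iff:
  assumes "1 \<le> k" "\<omega> \<in> space M" "k \<le> N"
  shows "(\<forall>m\<in>{k..N}. separated m \<omega>) \<longleftrightarrow>
    (\<forall>m\<in>{k..N}. if m = k then separated m \<omega> else few_moves m \<omega>)"
  using assms(3)
proof (induction N rule: dec_induct)
  case (step N)
  have "{k..Suc N} = insert (Suc N) {k..N}" "N \<in> {k..N}"
    using step.hyps by auto
  moreover have "separated N \<omega> \<Longrightarrow> separated (Suc N) \<omega> \<longleftrightarrow> few_moves (Suc N) \<omega>"
    using separated_Suc_iff[of N \<omega>] step.hyps assms by simp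
  moreover have "Suc N \<noteq> k"
    using step.hyps by simp
  ultimately show ?case
    using step.IH by (smt (verit, best) insert_iff)
qed auto

text \<open>The event is split by the set of movers, which is empty or a singleton;
  \<open>prod_one_plus_step\<close> turns the resulting sum into a ratio that telescopes in
  \<open>m\<close>.\<close>

lemma prob_few_moves:
  assumes "2 \<le> m"
  shows "prob {\<omega> \<in> space M. few_moves m \<omega>}
    = (\<Prod>i<n. 1 + real i / real m) / (\<Prod>i<n. 1 + real i / real (m - 1))"
proof -
  let ?S = "insert {} ((\<lambda>i. {i}) ` {..<n})"
  let ?A = "\<lambda>S. {\<omega> \<in> space M. \<forall>(l, i)\<in>{m} \<times> {..<n}. (i \<in> S) = (B l i \<omega> = l)}"
  let ?a = "1 / real m" and ?b = "1 - 1 / real m"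
  have "{\<omega> \<in> space M. few_moves m \<omega>} = (\<Union>S\<in>?S. ?A S)"
  proof (intro equalityI subsetI)
    fix \<omega> assume \<omega>: "\<omega> \<in> {\<omega> \<in> space M. few_moves m \<omega>}"
    define S where "S = {i. i < n \<and> B m i \<omega> = m}"
    have "S \<in> ?S"
    proof (cases "S = {}")
      case False
      then obtain i where "i \<in> S" by auto
      then have "S = {i}" "i < n"
        using \<omega> by (auto simp: S_def few_moves_def)
      then show ?thesis by auto
    qed auto
    moreover have "\<omega> \<in> ?A S"
      using \<omega> by (auto simp: S_def)
    ultimately show "\<omega> \<in> (\<Union>S\<in>?S. ?A S)" by blast
  next
    fix \<omega> assume "\<omega> \<in> (\<Union>S\<in>?S. ?A S)"
    then obtain S where S: "S \<in> ?S" "\<omega> \<in> ?A S" by blast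
    have "i = j" if "i < n" "j < n" "B m i \<omega> = m \<and> B m j \<omega> = m" for i j
    proof -
      have "i \<in> S" "j \<in> S" using S(2) that by auto
      with S(1) show ?thesis by auto
    qed
    with S(2) show "\<omega> \<in> {\<omega> \<in> space M. few_moves m \<omega>}"
      by (auto simp: few_moves_def)
  qed
  also have "prob \<dots> = (\<Sum>S\<in>?S. prob (?A S))"
  proof (rule finite_measure_finite_Union)
    show "?A ` ?S \<subseteq> events"
    proof (rule image_subsetI)
      fix S
      have [measurable]: "Measurable.pred M (\<lambda>\<omega>. B m i \<omega> = m)" if "i < n" for i
        using that pred_position assms by simp
      have "?A S = {\<omega> \<in> space M. \<forall>i\<in>{..<n}. (i \<in> S) = (B m i \<omega> = m)}"
        by auto
      also have "\<dots> \<in> events"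
        by measurable
      finally show "?A S \<in> events" .
    qed
    show "disjoint_family_on ?A ?S"
      by (auto simp: disjoint_family_on_def)
  qed auto
  also have "\<dots> = (\<Sum>S\<in>?S. \<Prod>i<n. if i \<in> S then ?a else ?b)"
  proof (intro sum.cong refl)
    fix S
    have "prob (?A S) = (\<Prod>(l, i)\<in>{m} \<times> {..<n}. prob {\<omega> \<in> space M. (i \<in> S) = (B l i \<omega> = l)})"
      by (rule prob_grid) (use assms in auto)
    also have "\<dots> = (\<Prod>i<n. prob {\<omega> \<in> space M. (i \<in> S) = (B m i \<omega> = m)})"
      by (simp flip: prod.cartesian_product)
    also have "\<dots> = (\<Prod>i<n. if i \<in> S then ?a else ?b)"
      using assms by (intro prod.cong) (auto simp: prob_relocate prob_not_relocate)
    finally show "prob (?A S) = (\<Prod>i<n. if i \<in> S then ?a else ?b)" .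
  qed
  also have "\<dots> = ?b ^ n + (\<Sum>i'<n. \<Prod>i<n. if i = i' then ?a else ?b)"
    by (subst sum.insert) (auto simp: sum.reindex)
  \<comment> \<open>For \<open>n = 0\<close> the truncated exponent \<open>n - 1\<close> is harmless
    because the sum is empty.\<close>
  also have "\<dots> = ?b ^ n + (\<Sum>i'<n. ?a * ?b ^ (n - 1))"
    by (auto intro!: sum.cong simp: prod.remove[of "{..<n}"] prod.If_cases Diff_eq[symmetric])
  \<comment> \<open>The power \<open>?b ^ n\<close> is factored out, using
    \<open>?a / ?b = 1 / (m - 1)\<close>.\<close>
  also have "\<dots> = ((real m - 1) / real m) ^ n * (1 + real n / (real m - 1))"
  proof (cases n)
    case (Suc l)
    have "?b = (real m - 1) / real m"
      using assms by (simp add: field_simps)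
    then show ?thesis
      using assms by (simp add: Suc divide_simps) (simp add: algebra_simps)
  qed simp
  also have "\<dots> = (\<Prod>i<n. 1 + real i / real m) / (\<Prod>i<n. 1 + real i / real (m - 1))"
  proof -
    have "(\<Prod>i<n. 1 + real i / real (m - 1)) > 0"
      by (intro prod_pos) (auto intro: add_pos_nonneg)
    then show ?thesis
      using prod_one_plus_step[of "real m" n] assms by (simp add: of_nat_diff field_simps)
  qed
  finally show ?thesis .
qed

lemma prob_separated_interval:
  assumes "1 \<le> k" "k \<le> N"
  shows "prob {\<omega> \<in> space M. \<forall>m\<in>{k..N}. separated m \<omega>}
    = (\<Prod>i<n. (real k - real i) / (real k + real i)) * (\<Prod>i<n. 1 + real i / real N)"
proof -
  \<comment> \<open>Index \<open>k\<close> stands for the whole history up to time \<open>k\<close>,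
    every later index only for its own time, so the blocks are disjoint.\<close>
  define I where "I = (\<lambda>j. if j = k then {2..k} \<times> {..<n} else {j} \<times> {..<n})"
  define P where "P = (\<lambda>j \<omega>. if j = k then separated j \<omega> else few_moves j \<omega>)"
  let ?g = "\<lambda>m. \<Prod>i<n. 1 + real i / real m"
  have g_pos: "?g m > 0" for m
    by (intro prod_pos) (auto intro: add_pos_nonneg)
  have indep: "indep_sets (\<lambda>j. sets (sigma (space M) (relocation ` I j))) {k..N}"
    by (rule indep_sets_relocations) (use assms in \<open>auto simp: I_def disjoint_family_on_def split: if_splits\<close>)
  have "{\<omega> \<in> space M. \<forall>m\<in>{k..N}. separated m \<omega>} = {\<omega> \<in> space M. \<forall>m\<in>{k..N}. P m \<omega>}"
    unfolding P_def by (intro Collect_cong conj_cong refl separated_interval_iff assms)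
  also have "prob \<dots> = (\<Prod>m\<in>{k..N}. prob {\<omega> \<in> space M. P m \<omega>})"
  proof (rule prob_Ball_indep_sets[OF indep])
    fix j assume j: "j \<in> {k..N}"
    let ?N = "sigma (space M) (relocation ` I j)"
    have "{\<omega> \<in> space ?N. P j \<omega>} \<in> sets ?N"
    proof (cases "j = k")
      case True
      have "B k i \<in> measurable ?N (count_space UNIV)" if "i < n" for i
        using that assms(1) True by (intro measurable_position) (auto simp: I_def)
      then show ?thesis
        using sets_Collect_inj_on[of "{..<n}" "B k" ?N] by (simp add: P_def True separated_def)
    next
      case False
      have [measurable]: "Measurable.pred ?N (\<lambda>\<omega>. B j i \<omega> = j)" if "i < n" for i
        using that False by (intro pred_relocation) (auto simp: I_def)
      have "{\<omega> \<in> space ?N. P j \<omega>}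
          = {\<omega> \<in> space ?N. \<forall>i\<in>{..<n}. \<forall>l\<in>{..<n}. B j i \<omega> = j \<and> B j l \<omega> = j \<longrightarrow> i = l}"
        using False by (auto simp: P_def few_moves_def)
      also have "\<dots> \<in> sets ?N" by measurable
      finally show ?thesis .
    qed
    then show "{\<omega> \<in> space M. P j \<omega>} \<in> sets ?N"
      by simp
  qed auto
  \<comment> \<open>The factors \<open>?g m / ?g (m - 1)\<close> for \<open>k < m \<le> N\<close>
    telescope.\<close>
  also have "\<dots> = (\<Prod>i<n. 1 - real i / real k) * (?g N / ?g k)"
    using assms(2)
  proof (induction N rule: dec_induct)
    case base
    then show ?case
      using less_imp_neq[OF g_pos[of k]] assms(1) by (simp add: P_def prob_separated del: prod_zero_iff)
  next
    case (step N)
    have "{k..Suc N} = insert (Suc N) {k..N}"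
      using step.hyps by auto
    then show ?case
      using step assms(1) less_imp_neq[OF g_pos[of N]] by (simp add: P_def prob_few_moves del: prod_zero_iff)
  qed
  also have "\<dots> = ((\<Prod>i<n. 1 - real i / real k) / ?g k) * ?g N"
    by simp
  also have "(\<Prod>i<n. 1 - real i / real k) / ?g k = (\<Prod>i<n. (real k - real i) / (real k + real i))"
    unfolding prod_dividef[symmetric]
  proof (rule prod.cong[OF refl])
    fix i
    have "1 - real i / real k = (real k - real i) / real k" "1 + real i / real k = (real k + real i) / real k"
      using assms(1) by (simp_all add: diff_divide_distrib add_divide_distrib)
    then show "(1 - real i / real k) / (1 + real i / real k) = (real k - real i) / (real k + real i)"
      using assms(1) by simp
  qed
  finally show ?thesis .
qed

section \<open>The time of permanent detachment\<close>

lemma num_lonely_eq_iff: "num_lonely n B k \<omega> = n \<longleftrightarrow> separated k \<omega>"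
proof -
  let ?L = "{i. i < n \<and> lonely n B k i \<omega>}"
  have "card ?L = n \<longleftrightarrow> ?L = {..<n}"
    by (metis (no_types, lifting) card_lessThan card_subset_eq finite_lessThan lessThan_iff mem_Collect_eq subsetI)
  also have "\<dots> \<longleftrightarrow> separated k \<omega>"
    by (auto simp: separated_iff lonely_def)
  finally show ?thesis
    by (simp add: num_lonely_def)
qed

text \<open>A finite infimum in \<open>enat\<close> is attained, and permanent separation from some
  time on persists from every later time on. The empty set gives infinity, which lies above every
  \<open>enat k\<close>.\<close>

lemma permanent_detachment_time_le_iff:
  assumes "1 \<le> k"
  shows "permanent_detachment_time n B \<omega> \<le> enat k \<longleftrightarrow> (\<forall>m\<ge>k. separated m \<omega>)"
proof -
  let ?K = "{k. 1 \<le> k \<and> (\<forall>j. separated (k + j) \<omega>)}"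
  have tau: "permanent_detachment_time n B \<omega> = Inf (enat ` ?K)"
    by (simp add: permanent_detachment_time_def num_lonely_eq_iff)
  show ?thesis
  proof
    assume le: "permanent_detachment_time n B \<omega> \<le> enat k"
    have "?K \<noteq> {}"
    proof
      assume "?K = {}"
      then have "permanent_detachment_time n B \<omega> = \<infinity>"
        unfolding tau by (metis Inf_enat_def image_empty)
      with le show False by simp
    qed
    then obtain l' where "enat l' \<in> enat ` ?K" by blast
    then have "Inf (enat ` ?K) \<in> enat ` ?K"
      by (rule wellorder_InfI)
    then obtain l where l: "\<forall>j. separated (l + j) \<omega>" "permanent_detachment_time n B \<omega> = enat l"
      unfolding tau by auto
    show "\<forall>m\<ge>k. separated m \<omega>"
    proof (intro allI impI)
      fix m assume "k \<le> m"
      moreover have "l \<le> k" using le l(2) by simp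
      ultimately have "m = l + (m - l)" by simp
      then show "separated m \<omega>" using l(1) by metis
    qed
  next
    assume "\<forall>m\<ge>k. separated m \<omega>"
    with assms have "enat k \<in> enat ` ?K" by auto
    then show "permanent_detachment_time n B \<omega> \<le> enat k"
      unfolding tau by (rule Inf_lower)
  qed
qed

section \<open>Measurability of the detachment time\<close>

lemma permanent_detachment_time_ge_1: "1 \<le> permanent_detachment_time n B \<omega>"
  unfolding permanent_detachment_time_def by (rule Inf_greatest) (auto simp: one_enat_def)

lemma separated_in_events:
  assumes "1 \<le> k"
  shows "{\<omega> \<in> space M. separated k \<omega>} \<in> events"
  unfolding separated_def using assms by (intro sets_Collect_inj_on random_variable_bus) auto

text \<open>Exhibits the event as a countable decreasing intersection of events about finitely many
  times, for measurability and for continuity from above.\<close>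

lemma permanent_detachment_time_le_eq_INT:
  assumes "1 \<le> k"
  shows "{\<omega> \<in> space M. permanent_detachment_time n B \<omega> \<le> enat k}
    = (\<Inter>N. {\<omega> \<in> space M. \<forall>m\<in>{k..k + N}. separated m \<omega>})"
proof -
  have "(\<forall>m\<ge>k. separated m \<omega>) \<longleftrightarrow> (\<forall>N. \<forall>m\<in>{k..k + N}. separated m \<omega>)" for \<omega>
  proof (intro iffI allI impI)
    fix m assume *: "\<forall>N. \<forall>m\<in>{k..k + N}. separated m \<omega>" and "k \<le> m"
    then have "m \<in> {k..k + (m - k)}" by simp
    with * show "separated m \<omega>" by blast
  qed auto
  then show ?thesis
    unfolding permanent_detachment_time_le_iff[OF assms] by auto
qed

lemma separated_interval_in_events:
  assumes "1 \<le> k"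
  shows "{\<omega> \<in> space M. \<forall>m\<in>{k..N}. separated m \<omega>} \<in> events"
  using assms separated_in_events by (intro sets.sets_Collect_finite_All) auto

lemma permanent_detachment_time_le_in_events:
  "{\<omega> \<in> space M. permanent_detachment_time n B \<omega> \<le> enat k} \<in> events"
proof (cases "k = 0")
  case True
  \<comment> \<open>Positions at time 0 are unspecified, but the detachment time is at least 1, so
    this event is empty.\<close>
  have "\<not> permanent_detachment_time n B \<omega> \<le> enat 0" for \<omega>
    using permanent_detachment_time_ge_1[of \<omega>] by (auto simp: zero_enat_def[symmetric])
  then show ?thesis using True by simp
next
  case False
  then show ?thesis
    using permanent_detachment_time_le_eq_INT[of k] separated_interval_in_events[of k]
    by auto
qed

text \<open>Since \<open>enat\<close> is countable, preimages of points suffice, and these come from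
  the events \<open>?t \<omega> \<le> enat k\<close> by differences and complements.\<close>

lemma measurable_permanent_detachment_time:
  "permanent_detachment_time n B \<in> measurable M (count_space UNIV)"
proof -
  let ?t = "permanent_detachment_time n B"
  note [measurable] = permanent_detachment_time_le_in_events
  have "?t -` {a} \<inter> space M \<in> events" for a
  proof (cases a)
    case (enat k)
    have "?t -` {a} \<inter> space M
        = {\<omega> \<in> space M. ?t \<omega> \<le> enat k} - (\<Union>l\<in>{..<k}. {\<omega> \<in> space M. ?t \<omega> \<le> enat l})"
    proof -
      have "x = enat k \<longleftrightarrow> x \<le> enat k \<and> (\<forall>l<k. \<not> x \<le> enat l)" for x
        by (cases x) (auto, metis le_neq_implies_less order_refl)
      then show ?thesis by (auto simp: enat)
    qed
    also have "\<dots> \<in> events" by measurable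
    finally show ?thesis .
  next
    case infinity
    have "?t -` {a} \<inter> space M = space M - (\<Union>l. {\<omega> \<in> space M. ?t \<omega> \<le> enat l})"
    proof -
      have "x = \<infinity> \<longleftrightarrow> (\<forall>l. \<not> x \<le> enat l)" for x
        by (cases x) auto
      then show ?thesis by (auto simp: infinity)
    qed
    also have "\<dots> \<in> events" by measurable
    finally show ?thesis .
  qed
  then show ?thesis
    by (simp add: measurable_count_space_eq2_countable)
qed

section \<open>Distribution function, finiteness, tail and expectation\<close>

lemma prob_permanent_detachment_time_le:
  assumes "1 \<le> k"
  shows "prob {\<omega> \<in> space M. permanent_detachment_time n B \<omega> \<le> enat k}
    = (\<Prod>i<n. (real k - real i) / (real k + real i))"
proof -
  let ?A = "\<lambda>N. {\<omega> \<in> space M. \<forall>m\<in>{k..k + N}. separated m \<omega>}"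
  let ?p = "\<Prod>i<n. (real k - real i) / (real k + real i)"
  \<comment> \<open>Continuity from above; the events decrease as the horizon \<open>N\<close>
    grows.\<close>
  have "(\<lambda>N. prob (?A N)) \<longlonglongrightarrow> prob (\<Inter>N. ?A N)"
    by (rule finite_Lim_measure_decseq)
      (use assms separated_interval_in_events in \<open>auto simp: decseq_def\<close>)
  moreover have "(\<lambda>N. prob (?A N)) \<longlonglongrightarrow> ?p"
  proof -
    have "(\<lambda>N. ?p * (\<Prod>i<n. 1 + real i / real (N + k))) \<longlonglongrightarrow> ?p * 1"
      by (intro tendsto_mult tendsto_const LIMSEQ_ignore_initial_segment[OF tendsto_prod_one_plus])
    moreover have "prob (?A N) = ?p * (\<Prod>i<n. 1 + real i / real (N + k))" for N
      using prob_separated_interval[of k "k + N"] assms by (simp add: add.commute)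
    ultimately show ?thesis by simp
  qed
  ultimately show ?thesis
    unfolding permanent_detachment_time_le_eq_INT[OF assms] by (rule LIMSEQ_unique)
qed

lemma prob_permanent_detachment_time_gt:
  assumes "1 \<le> k"
  shows "prob {\<omega> \<in> space M. enat k < permanent_detachment_time n B \<omega>}
    = 1 - (\<Prod>i<n. (real k - real i) / (real k + real i))"
  using prob_neg[OF permanent_detachment_time_le_in_events[of k]]
    prob_permanent_detachment_time_le[OF assms] by (simp add: not_le)

text \<open>The event of an infinite time lies in every tail event, and the tail probabilities tend
  to 0.\<close>

lemma AE_permanent_detachment_time_finite:
  "AE \<omega> in M. permanent_detachment_time n B \<omega> < \<infinity>"
proof -
  let ?t = "permanent_detachment_time n B"
  note [measurable] = measurable_permanent_detachment_time
  have "prob {\<omega> \<in> space M. ?t \<omega> = \<infinity>} \<le> 0"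
  proof (rule tendsto_lowerbound)
    show "(\<lambda>k::nat. 1 - (\<Prod>i<n. (real k - real i) / (real k + real i))) \<longlonglongrightarrow> 0"
      using tendsto_diff[OF tendsto_const tendsto_prod_ratio[of n], of 1] by simp
    show "\<forall>\<^sub>F k::nat in sequentially. prob {\<omega> \<in> space M. ?t \<omega> = \<infinity>}
        \<le> 1 - (\<Prod>i<n. (real k - real i) / (real k + real i))"
      using eventually_ge_at_top[of 1]
    proof eventually_elim
      case (elim k)
      have "prob {\<omega> \<in> space M. ?t \<omega> = \<infinity>} \<le> prob {\<omega> \<in> space M. enat k < ?t \<omega>}"
        by (rule finite_measure_mono) auto
      then show ?case
        using prob_permanent_detachment_time_gt[OF elim] by simp
    qed
  qed simp
  then have "prob {\<omega> \<in> space M. \<not> ?t \<omega> < \<infinity>} = 0"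
    by (simp add: measure_le_0_iff)
  then show ?thesis
    by (subst AE_iff_measurable[OF _ refl]) (auto simp: emeasure_eq_measure)
qed

lemma asymp_equiv_prob_permanent_detachment_time_gt:
  "(\<lambda>k. prob {\<omega> \<in> space M. enat k < permanent_detachment_time n B \<omega>})
     \<sim>[at_top] (\<lambda>k. real n * (real n - 1) / real k)"
proof -
  have "\<forall>\<^sub>F k in at_top. prob {\<omega> \<in> space M. enat k < permanent_detachment_time n B \<omega>}
      = 1 - (\<Prod>i<n. (real k - real i) / (real k + real i))"
    using eventually_ge_at_top[of 1] by eventually_elim (rule prob_permanent_detachment_time_gt)
  then show ?thesis
    using asymp_equiv_one_minus_prod_ratio[of n] by (subst asymp_equiv_cong[OF _ always_eventually]) auto
qed

text \<open>The expectation is the sum of the tail probabilities, which are asymptotic to a multiple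
  of the harmonic series. The multiple is nonzero for \<open>n \<ge> 2\<close>; a single passenger
  is detached from time 1 on and has expectation 1.\<close>

lemma nn_integral_permanent_detachment_time:
  assumes "2 \<le> n"
  shows "(\<integral>\<^sup>+ \<omega>. ennreal_of_enat (permanent_detachment_time n B \<omega>) \<partial>M) = \<infinity>"
proof (rule ccontr)
  let ?p = "\<lambda>k. prob {\<omega> \<in> space M. enat k < permanent_detachment_time n B \<omega>}"
  assume "\<not> ?thesis"
  then have "(\<Sum>k. ennreal (?p k)) \<noteq> \<top>"
    by (simp add: nn_integral_enat_function[OF measurable_permanent_detachment_time] emeasure_eq_measure)
  then have summable: "summable ?p"
    by (intro summable_suminf_not_top) auto
  \<comment> \<open>This direction of the equivalence transfers the supposed summability from the
    tails to the harmonic terms.\<close>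
  have "(\<lambda>k. real n * (real n - 1) / real k) \<in> O(?p)"
    by (rule asymp_equiv_imp_bigo[OF asymp_equiv_symI[OF asymp_equiv_prob_permanent_detachment_time_gt]])
  then have "summable (\<lambda>k. real n * (real n - 1) / real k)"
    by (rule summable_comparison_test_bigo[rotated]) (simp add: summable)
  then have "summable (\<lambda>k. 1 / (real n * (real n - 1)) * (real n * (real n - 1) / real k))"
    by (rule summable_mult)
  then show False
    using not_summable_harmonic[where 'a=real] assms by (simp add: divide_inverse)
qed

end

theorem theorem3p1:
  fixes M :: "'a measure" and n :: nat
    and B :: "nat \<Rightarrow> nat \<Rightarrow> 'a \<Rightarrow> nat" and \<tau> :: "'a \<Rightarrow> enat"
  assumes "detachment_process M n B"
    and "1 \<le> n"
    and "\<tau> = permanent_detachment_time n B"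
  shows "\<tau> \<in> measurable M (count_space UNIV) \<and>
    (AE \<omega> in M. \<tau> \<omega> < \<infinity>) \<and>
    (\<lambda>k::nat. \<P>(\<omega> in M. \<tau> \<omega> > enat k)) \<sim>[at_top] (\<lambda>k. real n * (real n - 1) / real k) \<and>
    (2 \<le> n \<longrightarrow> (\<integral>\<^sup>+ \<omega>. ennreal_of_enat (\<tau> \<omega>) \<partial>M) = \<infinity>) \<and>
    (\<forall>k::nat. 1 \<le> k \<longrightarrow>
       \<P>(\<omega> in M. \<tau> \<omega> \<le> enat k) = real (k choose n) / real ((k + n - 1) choose n))"
proof -
  interpret detachment_process M n B by fact
  show ?thesis
    unfolding assms(3)
    using measurable_permanent_detachment_time AE_permanent_detachment_time_finite
      asymp_equiv_prob_permanent_detachment_time_gt nn_integral_permanent_detachment_time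
      prob_permanent_detachment_time_le prod_div_eq_binomial_ratio[OF _ assms(2)]
    by simp
qed

end
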